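(* For every possibilistic Kripke structure $M$, the function $Po=Po^M:2^{Paths(M)}\to[0,1]$ is a possibility measure on $\Omega=2^{Paths(M)}$. In general, however, the following condition does not hold: if $A_1\supseteq A_2\supseteq\cdots$ is a decreasing chain in $\Omega$, then $Po(\bigcap_{i}A_i)=\bigwedge_{i}Po(A_i)$. (That is, there exist a possibilistic Kripke structure $M$ and a decreasing chain $A_1\supseteq A_2\supseteq\cdots$ of subsets of $Paths(M)$ with $Po(\bigcap_i A_i)\ne\bigwedge_i Po(A_i)$.)
   Context: For subsets or families in $[0,1]$, $\vee$ denotes supremum and $\wedge$ infimum (with $\bigvee\emptyset=0$). A possibilistic Kripke structure is a tuple $M=(S,P,I,AP,L)$ where $S$ is a countable nonempty set of states; $P:S\times S\to[0,1]$ satisfies $\bigvee_{s'\in S}P(s,s')=1$ for all $s\in S$; $I:S\to[0,1]$ satisfies $\bigvee_{s\in S}I(s)=1$; $AP$ is a set of atomic propositions; and $L:S\to 2^{AP}$ is a labeling function. A path of $M$ is an infinite sequence $\pi=s_0s_1s_2\cdots\in S^\omega$ with $P(s_i,s_{i+1})>0$ for all $i\ge 0$; $Paths(M)$ is the set of all paths. Define $Po^M(\pi)=I(s_0)\wedge\bigwedge_{i=0}^\infty P(s_i,s_{i+1})$ for $\pi=s_0s_1\cdots\in Paths(M)$, and $Po^M(A)=\bigvee\{Po^M(\pi)\mid\pi\in A\}$ for $A\subseteq Paths(M)$. A possibility measure on $\Omega=2^X$ ($X$ a nonempty set) is a map $m:\Omega\to[0,1]$ such that (i) $m(\emptyset)=0$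 and $m(X)=1$; (ii) $A\subseteq B$ implies $m(A)\le m(B)$; (iii) $m(\bigcup_{i\in J}A_i)=\bigvee_{i\in J}m(A_i)$ for every family $(A_i)_{i\in J}$ in $\Omega$. *)

theory Defs
  imports Complex_Main "HOL-Library.Countable_Set"
begin

(* Supremum in the complete lattice [0,1]. For real numbers Sup {} is unspecified, whereas the
   supremum of the empty family in [0,1] is 0. Infima below are only taken over nonempty
   families, so the INF of the reals is used directly. *)
definition usup :: "real set \<Rightarrow> real" where
  "usup A = (if A = {} then 0 else Sup A)"

record ('s, 'a) kripke =
  states :: "'s set"
  trans_poss :: "'s \<Rightarrow> 's \<Rightarrow> real"
  init_poss :: "'s \<Rightarrow> real"
  atoms :: "'a set"
  label :: "'s \<Rightarrow> 'a set"

(* The component functions are total on the type 's; only their values on the set of states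
   are constrained or used. *)
definition possibilistic_kripke :: "('s, 'a) kripke \<Rightarrow> bool" where
  "possibilistic_kripke M \<longleftrightarrow>
     countable (states M) \<and> states M \<noteq> {} \<and>
     (\<forall>s\<in>states M. \<forall>t\<in>states M. trans_poss M s t \<in> {0..1}) \<and>
     (\<forall>s\<in>states M. usup {trans_poss M s t |t. t \<in> states M} = 1) \<and>
     (\<forall>s\<in>states M. init_poss M s \<in> {0..1}) \<and>
     usup {init_poss M s |s. s \<in> states M} = 1 \<and>
     (\<forall>s\<in>states M. label M s \<subseteq> atoms M)"

definition Paths :: "('s, 'a) kripke \<Rightarrow> (nat \<Rightarrow> 's) set" where
  "Paths M = {\<pi>. (\<forall>i. \<pi> i \<in> states M) \<and> (\<forall>i. trans_poss M (\<pi> i) (\<pi> (Suc i)) > 0)}"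

definition path_poss :: "('s, 'a) kripke \<Rightarrow> (nat \<Rightarrow> 's) \<Rightarrow> real" where
  "path_poss M \<pi> = min (init_poss M (\<pi> 0)) (INF i. trans_poss M (\<pi> i) (\<pi> (Suc i)))"

definition Po :: "('s, 'a) kripke \<Rightarrow> (nat \<Rightarrow> 's) set \<Rightarrow> real" where
  "Po M A = usup {path_poss M \<pi> |\<pi>. \<pi> \<in> A}"

(* A set \<A> of subsets of X plays the role of a family in the last clause: both sides of the
   equation depend only on the range of the family, and a quantifier over index types is not
   available. The version for indexed families is possibility_measure_UN. *)
definition possibility_measure :: "'x set \<Rightarrow> ('x set \<Rightarrow> real) \<Rightarrow> bool" where
  "possibility_measure X m \<longleftrightarrow>
     X \<noteq> {} \<and>
     (\<forall>A\<subseteq>X. m A \<in> {0..1}) \<and>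
     m {} = 0 \<and> m X = 1 \<and>
     (\<forall>A B. A \<subseteq> B \<and> B \<subseteq> X \<longrightarrow> m A \<le> m B) \<and>
     (\<forall>\<A>\<subseteq>Pow X. m (\<Union>\<A>) = usup {m A |A. A \<in> \<A>})"

lemma possibility_measure_UN:
  assumes "possibility_measure X m" and "\<And>i. i \<in> J \<Longrightarrow> A i \<subseteq> X"
  shows "m (\<Union>i\<in>J. A i) = usup {m (A i) |i. i \<in> J}"
proof -
  have "A ` J \<subseteq> Pow X"
    using assms(2) by blast
  then have "m (\<Union>(A ` J)) = usup {m B |B. B \<in> A ` J}"
    using assms(1) unfolding possibility_measure_def by simp
  moreover have "{m B |B. B \<in> A ` J} = {m (A i) |i. i \<in> J}"
    by blast
  ultimately show ?thesis
    by simp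
qed

end

(* Only Po(Paths) = 1 needs an argument: for every c < 1 choose an initial state, and then
   successors one after another, all of possibility > c; the infimum along the resulting path is
   at least c, because an infimum, unlike a product, does not degrade with the length of the path.
   Continuity from above fails when every transition and initial possibility is 1 on the state
   space of the naturals: the paths starting at or above n have possibility 1 for each n, but no
   path lies in all these sets. *)
theory Submission imports Defs begin

text \<open>The conjunct \<open>0 \<le> c\<close> makes the equivalence hold for the empty family
  too, whose supremum is 0; for nonempty \<open>A\<close> it follows from
  \<open>A \<subseteq> {0..1}\<close>. Suprema can then be handled through their upper bounds
  without case splits.\<close>

lemma usup_le_iff:
  assumes "A \<subseteq> {0..1}"
  shows "usup A \<le> c \<longleftrightarrow> 0 \<le> c \<and> (\<forall>a\<in>A. a \<le> c)"
proof (cases "A = {}")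
  case False
  have "bdd_above A"
    using assms by (meson bdd_above_Icc bdd_above_mono)
  then have "usup A \<le> c \<longleftrightarrow> (\<forall>a\<in>A. a \<le> c)"
    using False by (simp add: usup_def cSup_le_iff)
  then show ?thesis
    using False assms by fastforce
qed (simp add: usup_def)

lemma usup_mem:
  assumes "A \<subseteq> {0..1}"
  shows "usup A \<in> {0..1}"
proof -
  have "usup A \<le> 1"
    using assms by (subst usup_le_iff) auto
  \<comment> \<open>With \<open>c\<close> taken to be the supremum itself the left side is trivial,
    so the right side can be read off. The same instantiation later yields that \<open>Po\<close>
    bounds the possibility of each of its paths.\<close>
  moreover have "0 \<le> usup A"
    using usup_le_iff[OF assms, of "usup A"] by simp
  ultimately show ?thesis by simp
qed

lemma less_usup_iff:
  assumes "A \<subseteq> {0..1}" "0 \<le> c"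
  shows "c < usup A \<longleftrightarrow> (\<exists>a\<in>A. c < a)"
  using usup_le_iff[OF assms(1), of c] assms(2) by (auto simp: not_le[symmetric])

lemma path_poss_mem:
  assumes "possibilistic_kripke M" "\<pi> \<in> Paths M"
  shows "path_poss M \<pi> \<in> {0..1}"
proof -
  let ?f = "\<lambda>i. trans_poss M (\<pi> i) (\<pi> (Suc i))"
  have "init_poss M (\<pi> 0) \<in> {0..1}" and f: "\<And>i. ?f i \<in> {0..1}"
    using assms by (auto simp: possibilistic_kripke_def Paths_def)
  moreover have "0 \<le> (INF i. ?f i)"
    using f by (intro cINF_greatest) auto
  ultimately show ?thesis
    by (auto simp: path_poss_def min_def)
qed

lemma path_poss_image_subset:
  assumes "possibilistic_kripke M" "A \<subseteq> Paths M"
  shows "{path_poss M \<pi> |\<pi>. \<pi> \<in> A} \<subseteq> {0..1}"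
  using path_poss_mem[OF assms(1)] assms(2) by blast

lemma Po_mem:
  assumes "possibilistic_kripke M" "A \<subseteq> Paths M"
  shows "Po M A \<in> {0..1}"
  unfolding Po_def by (rule usup_mem[OF path_poss_image_subset[OF assms]])

lemma Po_le_iff:
  assumes "possibilistic_kripke M" "A \<subseteq> Paths M"
  shows "Po M A \<le> c \<longleftrightarrow> 0 \<le> c \<and> (\<forall>\<pi>\<in>A. path_poss M \<pi> \<le> c)"
  unfolding Po_def usup_le_iff[OF path_poss_image_subset[OF assms]] by blast

lemma exists_path_ge:
  assumes M: "possibilistic_kripke M" and c: "0 \<le> c" "c < 1"
  obtains \<pi> where "\<pi> \<in> Paths M" "c \<le> path_poss M \<pi>"
proof -
  have "{init_poss M s |s. s \<in> states M} \<subseteq> {0..1}"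
    and "c < usup {init_poss M s |s. s \<in> states M}"
    using M c(2) by (auto simp: possibilistic_kripke_def)
  then obtain s0 where s0: "s0 \<in> states M" "c < init_poss M s0"
    by (auto simp: less_usup_iff c(1))
  have "\<exists>t. t \<in> states M \<and> c < trans_poss M s t" if "s \<in> states M" for s
  proof -
    have "{trans_poss M s t |t. t \<in> states M} \<subseteq> {0..1}"
      and "c < usup {trans_poss M s t |t. t \<in> states M}"
      using M c(2) that by (auto simp: possibilistic_kripke_def)
    then show ?thesis
      by (auto simp: less_usup_iff c(1))
  qed
  \<comment> \<open>The clause for \<open>i = 0\<close> pins the start of the chosen sequence to
    \<open>s0\<close>.\<close>
  then have "\<exists>\<pi>. \<forall>i. (\<pi> i \<in> states M \<and> (i = 0 \<longrightarrow> \<pi> i = s0)) \<and> c < trans_poss M (\<pi> i) (\<pi> (Suc i))"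
    using s0(1) by (intro dependent_nat_choice) auto
  then obtain \<pi> where \<pi>: "\<And>i. \<pi> i \<in> states M" "\<pi> 0 = s0"
    "\<And>i. c < trans_poss M (\<pi> i) (\<pi> (Suc i))"
    by blast
  \<comment> \<open>The strict bound above \<open>c \<ge> 0\<close> makes every transition
    possibility positive, as a path requires.\<close>
  have "\<pi> \<in> Paths M"
    using \<pi> le_less_trans[OF c(1)] by (simp add: Paths_def)
  \<comment> \<open>Values strictly above \<open>c\<close> may have infimum exactly
    \<open>c\<close>, so strictness is lost here.\<close>
  moreover have "c \<le> (INF i. trans_poss M (\<pi> i) (\<pi> (Suc i)))"
    using \<pi>(3) by (intro cINF_greatest) (auto intro: less_imp_le)
  then have "c \<le> path_poss M \<pi>"
    using \<pi>(2) s0(2) by (simp add: path_poss_def)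
  ultimately show thesis by (rule that)
qed

lemma Po_Paths:
  assumes "possibilistic_kripke M"
  shows "Po M (Paths M) = 1"
proof (rule antisym)
  show "Po M (Paths M) \<le> 1"
    using Po_mem[OF assms subset_refl] by simp
  show "1 \<le> Po M (Paths M)"
  \<comment> \<open>Possibility 1 need not be attained by any single path, so 1 is approached by all
    \<open>c\<close> strictly between 0 and 1.\<close>
  proof (rule dense_le_bounded[of 0])
    fix c :: real assume "0 < c" "c < 1"
    then obtain \<pi> where "\<pi> \<in> Paths M" "c \<le> path_poss M \<pi>"
      using exists_path_ge[OF assms, of c] by auto
    then show "c \<le> Po M (Paths M)"
      using Po_le_iff[OF assms subset_refl, of "Po M (Paths M)"] by fastforce
  qed simp
qed

text \<open>Two reals with the same upper bounds are equal. On either side, \<open>c\<close> is an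
  upper bound iff \<open>0 \<le> c\<close> and \<open>c\<close> bounds the possibility of every path
  in every member of \<open>\<A>\<close>.\<close>

lemma Po_Union:
  assumes M: "possibilistic_kripke M" and \<A>: "\<A> \<subseteq> Pow (Paths M)"
  shows "Po M (\<Union>\<A>) = usup {Po M A |A. A \<in> \<A>}"
proof -
  have sub: "A \<subseteq> Paths M" if "A \<in> \<A>" for A
    using \<A> that by blast
  have U: "\<Union>\<A> \<subseteq> Paths M"
    using \<A> by blast
  have V: "{Po M A |A. A \<in> \<A>} \<subseteq> {0..1}"
    using Po_mem[OF M] sub by blast
  have "Po M (\<Union>\<A>) \<le> c \<longleftrightarrow> usup {Po M A |A. A \<in> \<A>} \<le> c" for c
    unfolding Po_le_iff[OF M U] usup_le_iff[OF V] using Po_le_iff[OF M sub, of _ c] by blast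
  then show ?thesis
    by (meson order_antisym order_refl)
qed

theorem possibility_measure_Po:
  assumes M: "possibilistic_kripke M"
  shows "possibility_measure (Paths M) (Po M)"
  unfolding possibility_measure_def
proof (intro conjI allI impI)
  show "Paths M \<noteq> {}"
    using exists_path_ge[OF M, of 0] by auto
  show "Po M {} = 0"
    by (simp add: Po_def usup_def)
  show "Po M A \<le> Po M B" if "A \<subseteq> B \<and> B \<subseteq> Paths M" for A B
  proof -
    have "A \<subseteq> Paths M" and B: "B \<subseteq> Paths M"
      using that by auto
    then show ?thesis
      using that Po_le_iff[OF M B, of "Po M B"] by (auto simp: Po_le_iff[OF M])
  qed
qed (use Po_mem[OF M] Po_Paths[OF M] Po_Union[OF M] in auto)

lemma Po_not_continuous_from_above:
  "\<exists>(M :: (nat, 'a) kripke) (A :: nat \<Rightarrow> (nat \<Rightarrow> nat) set).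
     possibilistic_kripke M \<and> (\<forall>n. A n \<subseteq> Paths M) \<and> (\<forall>n. A (Suc n) \<subseteq> A n) \<and>
     Po M (\<Inter>n. A n) \<noteq> (INF n. Po M (A n))"
proof -
  define M :: "(nat, 'a) kripke" where
    "M = \<lparr>states = UNIV, trans_poss = \<lambda>_ _. 1, init_poss = \<lambda>_. 1, atoms = {}, label = \<lambda>_. {}\<rparr>"
  define A :: "nat \<Rightarrow> (nat \<Rightarrow> nat) set" where "A n = {\<pi>. n \<le> \<pi> 0}" for n
  have "possibilistic_kripke M"
    by (simp add: possibilistic_kripke_def M_def usup_def)
  moreover have "Paths M = UNIV"
    by (simp add: Paths_def M_def)
  \<comment> \<open>A sequence \<open>\<pi>\<close> is missing from
    \<open>A (Suc (\<pi> 0))\<close>.\<close>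
  moreover have "(\<Inter>n. A n) = {}"
    using not_less_eq_eq by (auto simp: A_def)
  then have "Po M (\<Inter>n. A n) = 0"
    by (simp add: Po_def usup_def)
  moreover have "Po M (A n) = 1" for n
  proof -
    \<comment> \<open>The constant sequence shows that \<open>A n\<close> is nonempty, so that its
      supremum is 1 and not the default 0.\<close>
    have "(\<lambda>_. n) \<in> A n"
      by (simp add: A_def)
    then have "{path_poss M \<pi> |\<pi>. \<pi> \<in> A n} = {1}"
      by (auto simp: path_poss_def M_def)
    then show ?thesis
      by (simp add: Po_def usup_def)
  qed
  moreover have "\<forall>n. A (Suc n) \<subseteq> A n"
    by (auto simp: A_def)
  ultimately show ?thesis
    by (intro exI[of _ M] exI[of _ A]) simp
qed

theorem theorem8:
  "(\<forall>M :: ('s, 'a) kripke. possibilistic_kripke M \<longrightarrow> possibility_measure (Paths M) (Po M)) \<and>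
   (\<exists>(M :: (nat, nat) kripke) (A :: nat \<Rightarrow> (nat \<Rightarrow> nat) set).
      possibilistic_kripke M \<and> (\<forall>n. A n \<subseteq> Paths M) \<and> (\<forall>n. A (Suc n) \<subseteq> A n) \<and>
      Po M (\<Inter>n. A n) \<noteq> (INF n. Po M (A n)))"
  using possibility_measure_Po Po_not_continuous_from_above by blast

end
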